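(* Let $\mathsf{k}$ be a field and let $A=\bigoplus_{n\ge 0}A_n$ be an affine $\mathbb{N}$-graded $\mathsf{k}$-algebra with all $A_n$ finite dimensional, such that $\mathsf{DIM}(A)<1$. Then $\mathrm{H}(A)=1$ if $A$ is infinite dimensional, and $\mathrm{H}(A)=0$ otherwise.
   Context: All algebras are associative and unital over an arbitrary base field $\mathsf{k}$; $\mathbb{N}=\{0,1,2,\dots\}$. An algebra is affine if it is finitely generated as an algebra. $\mathbb{N}$-graded means $A=\bigoplus_{n\ge0}A_n$ with subspaces $A_n$ satisfying $A_nA_m\subseteq A_{n+m}$. The entropy of $A$ is $\mathrm{H}(A)=\limsup_{n\to\infty}\sqrt[n]{\dim A_n}$. For an affine algebra $A$ and a finite-dimensional subspace $V\subseteq A$ containing $1$ and generating $A$ as an algebra, let $V^0=\mathsf{k}$, $V^n=\operatorname{span}\{a_1\cdots a_n: a_j\in V\}$ for $n>0$, and $d_V(n)=\dim V^n$. The Gelfand-Kirillov superdimension of $A$ is $\mathsf{DIM}(A)=\limsup_{n\to\infty}\frac{\log\log d_V(n)}{\log n}$, which is independent of the choice of $V$. *)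

theory Defs
  imports Complex_Main "HOL-Library.Extended_Real" "HOL-Library.Liminf_Limsup"
begin

text \<open>
  The sort \<open>{ring, monoid_mult}\<close> is that of associative rings with unit; unlike
  \<open>ring_1\<close> it does not exclude the zero ring.
\<close>

locale unital_algebra = vector_space scale
  for scale :: "'k::field \<Rightarrow> 'a::{ring,monoid_mult} \<Rightarrow> 'a" +
  assumes scale_mult_left: "scale c x * y = scale c (x * y)"
    and scale_mult_right: "x * scale c y = scale c (x * y)"
begin

definition fin_dim :: "'a set \<Rightarrow> bool" where
  "fin_dim V \<longleftrightarrow> (\<exists>B. finite B \<and> V \<subseteq> span B)"

definition subalgebra :: "'a set \<Rightarrow> bool" where
  "subalgebra B \<longleftrightarrow> subspace B \<and> 1 \<in> B \<and> (\<forall>x\<in>B. \<forall>y\<in>B. x * y \<in> B)"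

definition generates_algebra :: "'a set \<Rightarrow> bool" where
  "generates_algebra S \<longleftrightarrow> subalgebra hull S = UNIV"

definition affine_algebra :: bool where
  "affine_algebra \<longleftrightarrow> (\<exists>S. finite S \<and> generates_algebra S)"

definition generating_subspace :: "'a set \<Rightarrow> bool" where
  "generating_subspace V \<longleftrightarrow> subspace V \<and> fin_dim V \<and> 1 \<in> V \<and> generates_algebra V"

text \<open>For \<open>n = 0\<close> only the empty product \<open>1\<close> occurs, so \<open>subspace_power V 0\<close> is the line \<open>k 1\<close>.\<close>

definition subspace_power :: "'a set \<Rightarrow> nat \<Rightarrow> 'a set" where
  "subspace_power V n = span {prod_list as |as. length as = n \<and> set as \<subseteq> V}"

definition growth :: "'a set \<Rightarrow> nat \<Rightarrow> nat" where
  "growth V n = dim (subspace_power V n)"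

end

text \<open>
  The iterated logarithm takes the value \<open>-\<infinity>\<close> at \<open>1\<close> (whereas \<open>ln 0 = 0\<close> in the library).
  The value at \<open>0\<close> is only relevant for the zero algebra.
\<close>

definition loglog :: "nat \<Rightarrow> ereal" where
  "loglog d = (if d \<le> 1 then -\<infinity> else ereal (ln (ln (real d))))"

context unital_algebra
begin

definition superdim_wrt :: "'a set \<Rightarrow> ereal" where
  "superdim_wrt V = limsup (\<lambda>n. loglog (growth V n) / ereal (ln (real n)))"

text \<open>
  The value of \<open>superdim_wrt V\<close> is the same for every generating subspace \<open>V\<close>, and such
  a \<open>V\<close> exists precisely for affine algebras; hence the choice below is immaterial.
\<close>

definition GK_superdim :: ereal where
  "GK_superdim = superdim_wrt (SOME V. generating_subspace V)"

text \<open>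
  The second conjunct says that the sum of the \<open>A n\<close> is direct and is the whole algebra.
\<close>

definition nat_graded :: "(nat \<Rightarrow> 'a set) \<Rightarrow> bool" where
  "nat_graded A \<longleftrightarrow>
     (\<forall>n. subspace (A n)) \<and>
     (\<forall>x. \<exists>!f. (\<forall>n. f n \<in> A n) \<and> finite {n. f n \<noteq> 0} \<and> x = (\<Sum>n | f n \<noteq> 0. f n)) \<and>
     (\<forall>n m. \<forall>x\<in>A n. \<forall>y\<in>A m. x * y \<in> A (n + m))"

definition graded_entropy :: "(nat \<Rightarrow> 'a set) \<Rightarrow> ereal" where
  "graded_entropy A = limsup (\<lambda>n. ereal (root n (real (dim (A n)))))"

end

end

theory Submission
  imports Defs
begin

text \<open>
  Fix a finite-dimensional generating subspace \<open>V\<close> containing \<open>1\<close>. The upper bound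
  \<open>H(A) \<le> 1\<close> comes from a linear comparison of the grading with the filtration by powers of \<open>V\<close>:
  there is a constant \<open>c\<close> with \<open>A\<^sub>n \<subseteq> V\<^bsup>cn\<^esup>\<close> for all \<open>n \<ge> 1\<close>
  (\<open>component_subset_power_generating\<close>). To see this, let \<open>W = A\<^sub>0 \<oplus> \<dots> \<oplus> A\<^sub>D\<close> with \<open>D\<close> so
  large that \<open>V \<subseteq> W\<close>. An element of \<open>A\<^sub>n\<close> is a combination of products of homogeneous elements of
  \<open>W\<close> with degrees adding up to \<open>n\<close>. Any number of factors of degree \<open>0\<close> may occur, but
  \<open>A\<^sub>0 W \<subseteq> W\<close> and \<open>W A\<^sub>0 \<subseteq> W\<close>, so they can be absorbed into the factors of positive degree, and
  there are between \<open>1\<close> and \<open>n\<close> of these when \<open>n \<ge> 1\<close>. Since \<open>1 \<in> W\<close>, shorter products can be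
  padded, and hence \<open>A\<^sub>n \<subseteq> W\<^sup>n\<close> (\<open>component_subset_power\<close>).
  Since \<open>W\<close> is finite dimensional and the powers of \<open>V\<close> exhaust the algebra, \<open>W \<subseteq> V\<^sup>c\<close> for some \<open>c\<close>.

  If the superdimension is less than \<open>1\<close>, then \<open>d\<^sub>V(m) \<le> exp (m\<^sup>s)\<close> for some \<open>s < 1\<close> and all large
  \<open>m\<close>. The \<open>n\<close>-th root of \<open>dim A\<^sub>n\<close> is therefore at most \<open>exp ((cn)\<^sup>s / n)\<close>, which tends to \<open>1\<close>.

  The rest is the observation that, all \<open>A\<^sub>n\<close> being finite dimensional, the algebra is finite
  dimensional if and only if \<open>A\<^sub>n = 0\<close> for all large \<open>n\<close>. In the infinite-dimensional case
  \<open>dim A\<^sub>n \<ge> 1\<close> infinitely often, which gives \<open>H(A) \<ge> 1\<close>; in the other case the roots are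
  eventually \<open>0\<close>.
\<close>

section \<open>Dimension and products of spans\<close>

context unital_algebra
begin

lemma mult_span_subset:
  assumes X: "subspace X" and ST: "\<And>s t. s \<in> S \<Longrightarrow> t \<in> T \<Longrightarrow> s * t \<in> X"
    and x: "x \<in> span S" and y: "y \<in> span T"
  shows "x * y \<in> X"
proof -
  have "s * y \<in> X" if s: "s \<in> S" for s
    using y
  proof (induction rule: span_induct)
    case base
    show ?case
      by (auto intro!: subspaceI simp: subspace_0[OF X] distrib_left subspace_add[OF X]
          scale_mult_right subspace_scale[OF X])
  qed (use s ST in auto)
  show ?thesis
    using x
  proof (induction rule: span_induct)
    case base
    show ?case
      by (auto intro!: subspaceI simp: subspace_0[OF X] distrib_right subspace_add[OF X]
          scale_mult_left subspace_scale[OF X])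
  qed (use \<open>\<And>s. s \<in> S \<Longrightarrow> s * y \<in> X\<close> in auto)
qed

lemma fin_dim_basis:
  assumes "fin_dim V"
  obtains B where "finite B" "B \<subseteq> V" "V \<subseteq> span B" "card B = dim V"
proof -
  obtain C where C: "finite C" "V \<subseteq> span C"
    using assms unfolding fin_dim_def by blast
  obtain B where B: "B \<subseteq> V" "independent B" "V \<subseteq> span B" "card B = dim V"
    using basis_exists by blast
  have "finite B"
    using independent_span_bound[OF C(1) B(2)] B(1) C(2) by auto
  with B that show thesis by blast
qed

lemma dim_mono_fin_dim:
  assumes "fin_dim V" "U \<subseteq> V"
  shows "dim U \<le> dim V"
proof -
  obtain B where "finite B" "V \<subseteq> span B" "card B = dim V"
    using fin_dim_basis[OF assms(1)] by metis
  then show ?thesis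
    using dim_le_card[of U B] assms(2) by auto
qed

lemma dim_pos_if_nonzero:
  assumes "fin_dim V" "x \<in> V" "x \<noteq> 0"
  shows "1 \<le> dim V"
proof -
  obtain B where B: "finite B" "V \<subseteq> span B" "card B = dim V"
    using fin_dim_basis[OF assms(1)] by metis
  have "B \<noteq> {}"
    using B(2) assms by auto
  then have "0 < card B" using B(1) by (simp add: card_gt_0_iff)
  then show ?thesis using B(3) by simp
qed

lemma fin_dim_span_UN:
  assumes "finite I" "\<And>i. i \<in> I \<Longrightarrow> fin_dim (A i)"
  shows "fin_dim (span (\<Union>i\<in>I. A i))"
proof -
  obtain B where B: "\<And>i. i \<in> I \<Longrightarrow> finite (B i) \<and> A i \<subseteq> span (B i)"
    using assms(2) unfolding fin_dim_def by metis
  have "(\<Union>i\<in>I. A i) \<subseteq> span (\<Union>i\<in>I. B i)"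
    using B span_mono[of "B i" "\<Union>i\<in>I. B i" for i] by blast
  then have "span (\<Union>i\<in>I. A i) \<subseteq> span (\<Union>i\<in>I. B i)"
    by (simp add: span_minimal)
  moreover have "finite (\<Union>i\<in>I. B i)" using B assms(1) by blast
  ultimately show ?thesis unfolding fin_dim_def by blast
qed

section \<open>Powers of a subspace\<close>

lemma subspace_subspace_power: "subspace (subspace_power V n)"
  unfolding subspace_power_def by (rule subspace_span)

lemma prod_list_in_subspace_power:
  "set as \<subseteq> V \<Longrightarrow> prod_list as \<in> subspace_power V (length as)"
  unfolding subspace_power_def by (rule span_base) blast

lemma subset_subspace_power_1: "V \<subseteq> subspace_power V 1"
  using prod_list_in_subspace_power[of "[v]" V for v] by auto

lemma subspace_power_mult:
  assumes "x \<in> subspace_power V m" "y \<in> subspace_power V n"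
  shows "x * y \<in> subspace_power V (m + n)"
  using assms unfolding subspace_power_def[of V m] subspace_power_def[of V n]
proof (rule mult_span_subset[OF subspace_subspace_power, rotated])
  fix s t
  assume "s \<in> {prod_list as |as. length as = m \<and> set as \<subseteq> V}"
    and "t \<in> {prod_list as |as. length as = n \<and> set as \<subseteq> V}"
  then obtain as bs where "s = prod_list as" "length as = m" "set as \<subseteq> V"
    "t = prod_list bs" "length bs = n" "set bs \<subseteq> V"
    by blast
  then show "s * t \<in> subspace_power V (m + n)"
    using prod_list_in_subspace_power[of "as @ bs" V] by simp
qed

lemma subspace_power_mono:
  assumes "1 \<in> V" "m \<le> n"
  shows "subspace_power V m \<subseteq> subspace_power V n"
  unfolding subspace_power_def[of V m]
proof (rule span_minimal[OF _ subspace_subspace_power], safe)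
  fix as :: "'a list"
  assume "set as \<subseteq> V" "m = length as"
  \<comment> \<open>padding with the factor \<open>1\<close>\<close>
  moreover have "prod_list (as @ replicate (n - m) 1) = prod_list as"
    by (simp add: prod_list_replicate)
  moreover have "set (as @ replicate (n - m) 1) \<subseteq> V"
    using assms(1) \<open>set as \<subseteq> V\<close> by auto
  ultimately show "prod_list as \<in> subspace_power V n"
    using prod_list_in_subspace_power[of "as @ replicate (n - m) 1" V] assms(2) by auto
qed

lemma subspace_power_power:
  assumes "W \<subseteq> subspace_power V c"
  shows "subspace_power W n \<subseteq> subspace_power V (c * n)"
  unfolding subspace_power_def[of W]
proof (rule span_minimal[OF _ subspace_subspace_power], safe)
  fix as :: "'a list"
  assume "set as \<subseteq> W"
  then show "prod_list as \<in> subspace_power V (c * length as)"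
  proof (induction as)
    case Nil
    show ?case using prod_list_in_subspace_power[of "[]" V] by simp
  next
    case (Cons a as)
    then show ?case
      using subspace_power_mult[of a V c "prod_list as" "c * length as"] assms by auto
  qed
qed

lemma fin_dim_subspace_power:
  assumes "fin_dim V"
  shows "fin_dim (subspace_power V n)"
proof -
  obtain B where B: "finite B" "V \<subseteq> span B"
    using assms unfolding fin_dim_def by blast
  \<comment> \<open>products of elements of \<open>V\<close> reduce to the finitely many products of elements of \<open>B\<close>\<close>
  have "span B \<subseteq> subspace_power B 1"
    by (rule span_minimal[OF subset_subspace_power_1 subspace_subspace_power])
  then have "subspace_power V n \<subseteq> subspace_power B (1 * n)"
    using B(2) by (intro subspace_power_power) auto
  moreover have "finite {prod_list as |as. length as = n \<and> set as \<subseteq> B}"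
    using finite_imageI[OF finite_lists_length_eq[OF B(1), of n], of prod_list]
    by (rule rev_finite_subset) auto
  ultimately show ?thesis
    unfolding fin_dim_def subspace_power_def[of B] by auto
qed

lemma generates_algebraD:
  assumes "generates_algebra V" "subalgebra Q" "V \<subseteq> Q"
  shows "x \<in> Q"
proof -
  have "subalgebra hull V \<subseteq> Q" by (rule hull_minimal) (use assms in auto)
  then show ?thesis using assms(1) unfolding generates_algebra_def by auto
qed

text \<open>
  The powers of \<open>V\<close> increase because \<open>1 \<in> V\<close>, so their union is a subalgebra and therefore
  everything. Finitely many elements thus lie in a common power, and so does their span.
\<close>

lemma fin_dim_subset_subspace_power:
  assumes V: "generating_subspace V" and W: "fin_dim W"
  obtains c where "W \<subseteq> subspace_power V c"
proof -
  have 1: "1 \<in> V" and gen: "generates_algebra V"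
    using V unfolding generating_subspace_def by auto
  define Q where "Q = (\<Union>n. subspace_power V n)"
  have Q: "x \<in> Q \<longleftrightarrow> (\<exists>n. x \<in> subspace_power V n)" for x
    unfolding Q_def by simp
  have common: "\<exists>k. x \<in> subspace_power V k \<and> y \<in> subspace_power V k"
    if xy: "x \<in> Q" "y \<in> Q" for x y
  proof -
    obtain m n where mn: "x \<in> subspace_power V m" "y \<in> subspace_power V n"
      using xy unfolding Q by blast
    have "x \<in> subspace_power V (max m n)"
      using mn(1) subspace_power_mono[OF 1, of m "max m n"] by (simp add: subset_iff)
    moreover have "y \<in> subspace_power V (max m n)"
      using mn(2) subspace_power_mono[OF 1, of n "max m n"] by (simp add: subset_iff)
    ultimately show ?thesis by blast
  qed
  have "V \<subseteq> Q" using subset_subspace_power_1 unfolding Q_def by blast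
  moreover have "subalgebra Q"
    unfolding subalgebra_def
  proof (intro conjI ballI)
    show "subspace Q"
    proof (rule subspaceI)
      show "0 \<in> Q"
        unfolding Q using subspace_0[OF subspace_subspace_power] by (rule exI)
      show "x + y \<in> Q" if xy: "x \<in> Q" "y \<in> Q" for x y
      proof -
        obtain k where "x \<in> subspace_power V k" "y \<in> subspace_power V k"
          using common[OF xy] by blast
        then have "x + y \<in> subspace_power V k"
          by (rule subspace_add[OF subspace_subspace_power])
        then show ?thesis unfolding Q by (rule exI)
      qed
      show "scale c x \<in> Q" if x: "x \<in> Q" for c x
      proof -
        obtain k where "x \<in> subspace_power V k" using x unfolding Q by blast
        then have "scale c x \<in> subspace_power V k"
          by (rule subspace_scale[OF subspace_subspace_power])
        then show ?thesis unfolding Q by (rule exI)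
      qed
    qed
    show "1 \<in> Q" using \<open>V \<subseteq> Q\<close> 1 by (rule subsetD)
    show "x * y \<in> Q" if xy: "x \<in> Q" "y \<in> Q" for x y
    proof -
      obtain k where "x \<in> subspace_power V k" "y \<in> subspace_power V k"
        using common[OF xy] by blast
      then have "x * y \<in> subspace_power V (k + k)"
        by (rule subspace_power_mult)
      then show ?thesis unfolding Q by (rule exI)
    qed
  qed
  ultimately have "x \<in> Q" for x
    by (intro generates_algebraD[OF gen])
  then have "\<forall>x. \<exists>n. x \<in> subspace_power V n"
    unfolding Q by (rule allI)
  then obtain k where k: "\<forall>x. x \<in> subspace_power V (k x)"
    unfolding choice_iff by (rule exE)
  obtain B where B: "finite B" "W \<subseteq> span B"
    using W unfolding fin_dim_def by blast
  have "B \<subseteq> subspace_power V (Max (k ` B))"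
  proof
    fix b assume "b \<in> B"
    then have "k b \<le> Max (k ` B)" using B(1) by simp
    then show "b \<in> subspace_power V (Max (k ` B))"
      using subsetD[OF subspace_power_mono[OF 1]] k by simp
  qed
  then have "span B \<subseteq> subspace_power V (Max (k ` B))"
    by (rule span_minimal[OF _ subspace_subspace_power])
  with B(2) have "W \<subseteq> subspace_power V (Max (k ` B))" by (rule subset_trans)
  then show thesis by (rule that)
qed

lemma mult_left_subspace_power:
  assumes "\<And>w. w \<in> W \<Longrightarrow> a * w \<in> W" "x \<in> subspace_power W (Suc n)"
  shows "a * x \<in> subspace_power W (Suc n)"
proof (rule mult_span_subset[OF subspace_subspace_power])
  show "a \<in> span {a}" by (simp add: span_base)
  show "x \<in> span {prod_list as |as. length as = Suc n \<and> set as \<subseteq> W}"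
    using assms(2) unfolding subspace_power_def .
next
  fix s t
  assume "s \<in> {a}" and "t \<in> {prod_list as |as. length as = Suc n \<and> set as \<subseteq> W}"
  then obtain as where "s = a" "t = prod_list as" "length as = Suc n" "set as \<subseteq> W" by blast
  then show "s * t \<in> subspace_power W (Suc n)"
    using prod_list_in_subspace_power[of "(a * hd as) # tl as" W] assms(1)
    by (cases as) (auto simp: mult.assoc)
qed

lemma mult_right_subspace_power:
  assumes "\<And>w. w \<in> W \<Longrightarrow> w * a \<in> W" "x \<in> subspace_power W (Suc n)"
  shows "x * a \<in> subspace_power W (Suc n)"
proof (rule mult_span_subset[OF subspace_subspace_power])
  show "a \<in> span {a}" by (simp add: span_base)
  show "x \<in> span {prod_list as |as. length as = Suc n \<and> set as \<subseteq> W}"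
    using assms(2) unfolding subspace_power_def .
next
  fix s t
  assume "t \<in> {a}" and "s \<in> {prod_list as |as. length as = Suc n \<and> set as \<subseteq> W}"
  then obtain as where "t = a" "s = prod_list as" "length as = Suc n" "set as \<subseteq> W" by blast
  then show "s * t \<in> subspace_power W (Suc n)"
    using prod_list_in_subspace_power[of "butlast as @ [last as * a]" W] assms(1)
    by (cases as rule: rev_cases) (auto simp: mult.assoc)
qed

section \<open>Homogeneous components\<close>

definition component :: "(nat \<Rightarrow> 'a set) \<Rightarrow> 'a \<Rightarrow> nat \<Rightarrow> 'a" where
  "component A x = (THE f. (\<forall>n. f n \<in> A n) \<and> finite {n. f n \<noteq> 0} \<and> x = (\<Sum>n | f n \<noteq> 0. f n))"

context
  fixes A :: "nat \<Rightarrow> 'a set"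
  assumes graded: "nat_graded A"
begin

lemma subspace_homogeneous: "subspace (A n)"
  using graded unfolding nat_graded_def by blast

lemma homogeneous_mult: "x \<in> A m \<Longrightarrow> y \<in> A n \<Longrightarrow> x * y \<in> A (m + n)"
  using graded unfolding nat_graded_def by blast

lemma
  shows component_in: "component A x n \<in> A n"
    and finite_component: "finite {n. component A x n \<noteq> 0}"
    and sum_component: "(\<Sum>n | component A x n \<noteq> 0. component A x n) = x"
proof -
  have "\<exists>!f. (\<forall>n. f n \<in> A n) \<and> finite {n. f n \<noteq> 0} \<and> x = (\<Sum>n | f n \<noteq> 0. f n)"
    using graded unfolding nat_graded_def by blast
  from theI'[OF this, folded component_def]
  show "component A x n \<in> A n" "finite {n. component A x n \<noteq> 0}"
    "(\<Sum>n | component A x n \<noteq> 0. component A x n) = x"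
    by auto
qed

lemma component_unique:
  assumes f: "\<And>n. f n \<in> A n" and S: "finite S" "\<And>n. n \<notin> S \<Longrightarrow> f n = 0" and x: "x = (\<Sum>n\<in>S. f n)"
  shows "component A x = f"
proof -
  have sub: "{n. f n \<noteq> 0} \<subseteq> S" using S(2) by blast
  then have "x = (\<Sum>n | f n \<noteq> 0. f n)"
    unfolding x using S(1) by (intro sum.mono_neutral_right) auto
  moreover have "finite {n. f n \<noteq> 0}" using sub S(1) by (rule finite_subset)
  moreover have "\<exists>!f. (\<forall>n. f n \<in> A n) \<and> finite {n. f n \<noteq> 0} \<and> x = (\<Sum>n | f n \<noteq> 0. f n)"
    using graded unfolding nat_graded_def by blast
  ultimately show ?thesis
    unfolding component_def using f by (intro the1_equality) auto
qed

lemma sum_component_superset: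
  assumes "finite S" "{n. component A x n \<noteq> 0} \<subseteq> S"
  shows "(\<Sum>n\<in>S. component A x n) = x"
proof -
  have "(\<Sum>n\<in>S. component A x n) = (\<Sum>n | component A x n \<noteq> 0. component A x n)"
    using assms by (intro sum.mono_neutral_right) auto
  then show ?thesis using sum_component by simp
qed

lemma component_add: "component A (x + y) n = component A x n + component A y n"
proof -
  let ?S = "{n. component A x n \<noteq> 0} \<union> {n. component A y n \<noteq> 0}"
  have "finite ?S" using finite_component by simp
  then have "component A (x + y) = (\<lambda>n. component A x n + component A y n)"
    by (intro component_unique[of _ ?S])
      (auto simp: sum.distrib sum_component_superset component_in subspace_add[OF subspace_homogeneous])
  then show ?thesis by simp
qed

lemma component_scale: "component A (scale c x) n = scale c (component A x n)"
proof -
  let ?S = "{n. component A x n \<noteq> 0}"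
  have "component A (scale c x) = (\<lambda>n. scale c (component A x n))"
    by (intro component_unique[of _ ?S])
      (auto simp: finite_component sum_component scale_sum_right[symmetric] component_in
        subspace_scale[OF subspace_homogeneous])
  then show ?thesis by simp
qed

lemma component_homogeneous:
  assumes "x \<in> A m"
  shows "component A x n = (if n = m then x else 0)"
proof -
  have "component A x = (\<lambda>n. if n = m then x else 0)"
    by (intro component_unique[of _ "{m}"]) (auto simp: assms subspace_0[OF subspace_homogeneous])
  then show ?thesis by simp
qed

lemma component_0: "component A 0 n = 0"
  using component_homogeneous[OF subspace_0[OF subspace_homogeneous], of n n] by simp

lemma component_sum: "component A (\<Sum>i\<in>I. f i) n = (\<Sum>i\<in>I. component A (f i) n)"
  by (induction I rule: infinite_finite_induct) (simp_all add: component_0 component_add)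

lemma component_mult:
  "component A (x * y) n =
    (\<Sum>i | component A x i \<noteq> 0. \<Sum>j | component A y j \<noteq> 0.
      if i + j = n then component A x i * component A y j else 0)"
proof -
  have "component A (x * y) n =
      component A ((\<Sum>i | component A x i \<noteq> 0. component A x i) *
        (\<Sum>j | component A y j \<noteq> 0. component A y j)) n"
    by (simp only: sum_component)
  also have "\<dots> = (\<Sum>i | component A x i \<noteq> 0. \<Sum>j | component A y j \<noteq> 0.
      component A (component A x i * component A y j) n)"
    by (simp only: sum_product component_sum)
  also have "\<dots> = (\<Sum>i | component A x i \<noteq> 0. \<Sum>j | component A y j \<noteq> 0.
      if i + j = n then component A x i * component A y j else 0)"
    by (intro sum.cong refl)
      (auto simp: component_homogeneous[OF homogeneous_mult[OF component_in component_in]])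
  finally show ?thesis .
qed

lemma fin_dim_component_bound:
  assumes "fin_dim V"
  obtains D where "\<And>x n. x \<in> V \<Longrightarrow> D < n \<Longrightarrow> component A x n = 0"
proof -
  obtain B where B: "finite B" "V \<subseteq> span B"
    using assms unfolding fin_dim_def by blast
  have "finite (\<Union>b\<in>B. {n. component A b n \<noteq> 0})"
    using B(1) finite_component by blast
  then obtain D where D: "\<And>b n. b \<in> B \<Longrightarrow> component A b n \<noteq> 0 \<Longrightarrow> n \<le> D"
    unfolding finite_nat_set_iff_bounded_le by blast
  have "subspace {x. \<forall>n>D. component A x n = 0}"
    by (rule subspaceI) (auto simp: component_0 component_add component_scale)
  moreover have "B \<subseteq> {x. \<forall>n>D. component A x n = 0}"
    using D by fastforce
  ultimately have "span B \<subseteq> {x. \<forall>n>D. component A x n = 0}"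
    by (intro span_minimal)
  with B(2) that show thesis by blast
qed

lemma in_span_homogeneous:
  assumes "\<And>n. D < n \<Longrightarrow> component A x n = 0"
  shows "x \<in> span (\<Union>i\<le>D. A i)"
proof -
  have "component A x n \<in> span (\<Union>i\<le>D. A i)" if "n \<le> D" for n
    using component_in that by (intro span_base) blast
  then have "(\<Sum>n\<le>D. component A x n) \<in> span (\<Union>i\<le>D. A i)"
    by (intro span_sum) auto
  moreover have "(\<Sum>n\<le>D. component A x n) = x"
    by (rule sum_component_superset) (use assms in \<open>auto simp: not_less[symmetric]\<close>)
  ultimately show ?thesis by simp
qed

text \<open>
  The direct sum \<open>A\<^sub>0 \<oplus> \<dots> \<oplus> A\<^sub>D\<close> is a two-sided \<open>A\<^sub>0\<close>-module, which is what allows factors of degree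
  \<open>0\<close> to be absorbed without lengthening a product.
\<close>

lemma degree_zero_mult_span:
  assumes "a \<in> A 0" "w \<in> span (\<Union>i\<le>D. A i)"
  shows "a * w \<in> span (\<Union>i\<le>D. A i)" "w * a \<in> span (\<Union>i\<le>D. A i)"
proof -
  have a: "a \<in> span {a}" by (simp add: span_base)
  show "a * w \<in> span (\<Union>i\<le>D. A i)"
    by (rule mult_span_subset[OF subspace_span _ a assms(2)])
      (use homogeneous_mult[OF assms(1)] in \<open>force intro: span_base\<close>)
  show "w * a \<in> span (\<Union>i\<le>D. A i)"
    by (rule mult_span_subset[OF subspace_span _ assms(2) a])
      (use homogeneous_mult[OF _ assms(1)] in \<open>force intro: span_base\<close>)
qed

section \<open>Comparison of the grading with the powers of a generating subspace\<close>

text \<open>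
  With \<open>W = A\<^sub>0 \<oplus> \<dots> \<oplus> A\<^sub>D\<close>, the elements all of whose components of degree \<open>n > 0\<close> lie in \<open>W\<^sup>n\<close> form
  a subalgebra that contains \<open>V\<close>, hence are all elements. In a product, a factor of degree \<open>0\<close> is
  absorbed, and two factors of positive degrees \<open>i\<close> and \<open>j\<close> give an element of \<open>W\<^bsup>i+j\<^esup>\<close>. In degree
  \<open>0\<close> the condition on the component has to be void: \<open>W\<^sup>0\<close> is only the line spanned by \<open>1\<close>,
  which need not contain \<open>A\<^sub>0\<close>.
\<close>

lemma component_subset_power:
  assumes gen: "generates_algebra V" and 1: "1 \<in> V"
    and D: "V \<subseteq> span (\<Union>i\<le>D. A i)" and n: "0 < n"
  shows "A n \<subseteq> subspace_power (span (\<Union>i\<le>D. A i)) n"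
proof -
  define W where "W = span (\<Union>i\<le>D. A i)"
  define Q where "Q = {x. \<forall>n>0. component A x n \<in> subspace_power W n}"
  note sub = subspace_subspace_power[of W]
  have W1: "1 \<in> W" using 1 D unfolding W_def by blast
  have "subspace Q"
    unfolding Q_def
    by (rule subspaceI)
      (auto simp: component_0 component_add component_scale subspace_0[OF sub]
        subspace_add[OF sub] subspace_scale[OF sub])
  have W_Q: "W \<subseteq> Q"
  proof -
    have "x \<in> Q" if x: "i \<le> D" "x \<in> A i" for i x
    proof -
      have "x \<in> W" unfolding W_def using x by (intro span_base) blast
      then have "x \<in> subspace_power W n" if "0 < n" for n
        using subset_subspace_power_1[of W] subspace_power_mono[OF W1, of 1 n] that by auto
      then show ?thesis
        unfolding Q_def using component_homogeneous[OF x(2)] by (auto simp: subspace_0[OF sub])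
    qed
    then show ?thesis
      unfolding W_def using \<open>subspace Q\<close> by (intro span_minimal) auto
  qed
  have zero_l: "a * x \<in> subspace_power W n" if "a \<in> A 0" "x \<in> subspace_power W n" "0 < n" for a x n
    using mult_left_subspace_power[of W a x "n - 1"] degree_zero_mult_span(1)[OF that(1)] that
    unfolding W_def by simp
  have zero_r: "x * a \<in> subspace_power W n" if "a \<in> A 0" "x \<in> subspace_power W n" "0 < n" for a x n
    using mult_right_subspace_power[of W a x "n - 1"] degree_zero_mult_span(2)[OF that(1)] that
    unfolding W_def by simp
  have "subalgebra Q"
    unfolding subalgebra_def
  proof (intro conjI ballI)
    show "subspace Q" by fact
    show "1 \<in> Q" using W1 W_Q by blast
    fix x y
    assume xy: "x \<in> Q" "y \<in> Q"
    have "component A x i * component A y j \<in> subspace_power W (i + j)" if "0 < i + j" for i j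
    proof (cases "i = 0 \<or> j = 0")
      case True
      then show ?thesis
        using that xy zero_l[OF component_in[of x 0], of "component A y j" j]
          zero_r[OF component_in[of y 0], of "component A x i" i]
        unfolding Q_def by auto
    next
      case False
      then show ?thesis
        using xy unfolding Q_def by (intro subspace_power_mult) auto
    qed
    then have "component A (x * y) n \<in> subspace_power W n" if "0 < n" for n
      unfolding component_mult using that
      by (intro subspace_sum[OF sub]) (auto simp: subspace_0[OF sub])
    then show "x * y \<in> Q" unfolding Q_def by blast
  qed
  moreover have "V \<subseteq> Q" using W_Q D unfolding W_def by blast
  ultimately have all: "x \<in> Q" for x
    by (rule generates_algebraD[OF gen])
  show ?thesis
  proof
    fix x assume "x \<in> A n"
    then have "component A x n = x" by (simp add: component_homogeneous)
    moreover have "component A x n \<in> subspace_power W n"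
      using all[of x] n unfolding Q_def by blast
    ultimately show "x \<in> subspace_power (span (\<Union>i\<le>D. A i)) n"
      unfolding W_def by simp
  qed
qed

lemma component_subset_power_generating:
  assumes V: "generating_subspace V" and fin: "\<And>n. fin_dim (A n)"
  obtains c where "0 < c" "\<And>n. 0 < n \<Longrightarrow> A n \<subseteq> subspace_power V (c * n)"
proof -
  have V': "fin_dim V" "1 \<in> V" "generates_algebra V"
    using V unfolding generating_subspace_def by auto
  obtain D where "\<And>x n. x \<in> V \<Longrightarrow> D < n \<Longrightarrow> component A x n = 0"
    using fin_dim_component_bound[OF V'(1)] by blast
  then have D: "V \<subseteq> span (\<Union>i\<le>D. A i)"
    using in_span_homogeneous by blast
  have "fin_dim (span (\<Union>i\<le>D. A i))"
    using fin by (intro fin_dim_span_UN) auto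
  then obtain c where c: "span (\<Union>i\<le>D. A i) \<subseteq> subspace_power V c"
    using fin_dim_subset_subspace_power[OF V] by blast
  \<comment> \<open>the successor makes the factor positive, so that the exponents tend to infinity with \<open>n\<close>\<close>
  have "span (\<Union>i\<le>D. A i) \<subseteq> subspace_power V (Suc c)"
    using c subspace_power_mono[OF V'(2), of c "Suc c"] by auto
  note W_power = subspace_power_power[OF this]
  have "A n \<subseteq> subspace_power V (Suc c * n)" if "0 < n" for n
    using component_subset_power[OF V'(3,2) D that] W_power by (rule subset_trans)
  with that show thesis by blast
qed

text \<open>
  The elements of a finite spanning set have components in only finitely many degrees, and so have
  all their combinations; conversely, \<open>A\<^sub>0 \<oplus> \<dots> \<oplus> A\<^sub>D\<close> is finite dimensional for every \<open>D\<close>.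
\<close>

lemma fin_dim_UNIV_iff:
  assumes fin: "\<And>n. fin_dim (A n)"
  shows "fin_dim UNIV \<longleftrightarrow> (\<forall>\<^sub>F n in sequentially. A n \<subseteq> {0})"
proof
  assume "fin_dim UNIV"
  then obtain D where D: "\<And>x n. D < n \<Longrightarrow> component A x n = 0"
    using fin_dim_component_bound by (metis UNIV_I)
  have "A n \<subseteq> {0}" if "Suc D \<le> n" for n
    using D[of n] component_homogeneous[of _ n n] that by fastforce
  then show "\<forall>\<^sub>F n in sequentially. A n \<subseteq> {0}"
    unfolding eventually_sequentially by blast
next
  assume "\<forall>\<^sub>F n in sequentially. A n \<subseteq> {0}"
  then obtain D where "\<And>n. D \<le> n \<Longrightarrow> A n \<subseteq> {0}"
    unfolding eventually_sequentially by blast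
  then have "component A x n = 0" if "D < n" for x n
    using component_in[of x n] that by (meson less_imp_le singletonD subsetD)
  then have "UNIV \<subseteq> span (\<Union>i\<le>D. A i)"
    using in_span_homogeneous by blast
  moreover have "fin_dim (span (\<Union>i\<le>D. A i))"
    using fin by (intro fin_dim_span_UN) auto
  ultimately show "fin_dim UNIV"
    unfolding fin_dim_def by blast
qed

end

lemma affine_algebra_generating_subspace:
  assumes "affine_algebra"
  shows "generating_subspace (SOME V. generating_subspace V)"
proof (rule someI_ex)
  obtain S where S: "finite S" "generates_algebra S"
    using assms unfolding affine_algebra_def by blast
  let ?V = "span (insert 1 S)"
  have "subalgebra hull S \<subseteq> subalgebra hull ?V"
    by (rule hull_mono) (use span_superset in blast)
  then have "generates_algebra ?V"
    using S(2) unfolding generates_algebra_def by auto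
  then have "generating_subspace ?V"
    unfolding generating_subspace_def fin_dim_def using S(1)
    by (auto intro!: exI[of _ "insert 1 S"] span_base)
  then show "\<exists>V. generating_subspace V" ..
qed

end

section \<open>Subexponential growth and roots\<close>

lemma loglog_limsup_less_one:
  assumes "limsup (\<lambda>n. loglog (d n) / ereal (ln (real n))) < 1"
  obtains s where "s < 1" "\<forall>\<^sub>F n in sequentially. real (d n) \<le> exp (real n powr s)"
proof -
  obtain s where s: "limsup (\<lambda>n. loglog (d n) / ereal (ln (real n))) < ereal s" "ereal s < 1"
    using ereal_dense2[OF assms] by blast
  have "\<forall>\<^sub>F n in sequentially. loglog (d n) / ereal (ln (real n)) < ereal s"
    by (rule Limsup_lessD[OF s(1)])
  then have "\<forall>\<^sub>F n in sequentially. real (d n) \<le> exp (real n powr s)"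
    using eventually_ge_at_top[of 2]
  proof eventually_elim
    case (elim n)
    show ?case
    proof (cases "d n \<le> 1")
      case True
      then have "real (d n) \<le> 1" by simp
      also have "1 \<le> exp (real n powr s)" by simp
      finally show ?thesis .
    next
      case False
      have n: "0 < ln (real n)" using elim by simp
      have d: "0 < ln (real (d n))" using False by simp
      have "ln (ln (real (d n))) / ln (real n) < s"
        using elim False n by (simp add: loglog_def)
      then have "ln (ln (real (d n))) < s * ln (real n)"
        using n by (simp add: field_simps)
      then have "ln (real (d n)) < exp (s * ln (real n))"
        using d by (metis exp_less_mono exp_ln)
      also have "\<dots> = real n powr s"
        using elim by (simp add: powr_def)
      finally have "exp (ln (real (d n))) \<le> exp (real n powr s)" by simp
      then show ?thesis using False by simp
    qed
  qed
  with s(2) that show thesis by simp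
qed

text \<open>
  Replacing \<open>n\<close> by \<open>cn\<close> only costs the constant factor \<open>c\<^sup>s\<close> in the exponent, which is harmless since
  \<open>n\<^sup>s / n\<close> tends to \<open>0\<close>.
\<close>

lemma limsup_root_le_one:
  fixes f d :: "nat \<Rightarrow> nat"
  assumes c: "0 < c" and f: "\<And>n. 0 < n \<Longrightarrow> f n \<le> d (c * n)"
    and d: "\<forall>\<^sub>F n in sequentially. real (d n) \<le> exp (real n powr s)" and s: "s < 1"
  shows "limsup (\<lambda>n. ereal (root n (real (f n)))) \<le> 1"
proof -
  let ?g = "\<lambda>n. exp (real c powr s * real n powr (s - 1))"
  have "filterlim (\<lambda>n. c * n) sequentially sequentially"
    using c by (intro filterlim_subseq strict_monoI) auto
  then have "\<forall>\<^sub>F n in sequentially. real (d (c * n)) \<le> exp (real (c * n) powr s)"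
    using d unfolding filterlim_iff by blast
  then have "\<forall>\<^sub>F n in sequentially. ereal (root n (real (f n))) \<le> ereal (?g n)"
    using eventually_gt_at_top[of 0]
  proof eventually_elim
    case (elim n)
    have "real (f n) \<le> exp (real (c * n) powr s)"
      using f[of n] elim by linarith
    then have "root n (real (f n)) \<le> root n (exp (real (c * n) powr s))"
      using elim by (intro real_root_le_mono) auto
    also have "root n (exp (real (c * n) powr s)) = exp (real (c * n) powr s / real n)"
      using elim by (simp add: root_powr_inverse powr_def divide_inverse mult.commute)
    also have "real (c * n) powr s / real n = real c powr s * real n powr (s - 1)"
      using elim by (simp add: powr_mult powr_diff)
    finally show ?case by simp
  qed
  then have "limsup (\<lambda>n. ereal (root n (real (f n)))) \<le> limsup (\<lambda>n. ereal (?g n))"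
    by (rule Limsup_mono)
  also have "limsup (\<lambda>n. ereal (?g n)) = 1"
  proof (rule lim_imp_Limsup)
    have "(\<lambda>n. real n powr (s - 1)) \<longlonglongrightarrow> 0"
      using s by (intro tendsto_neg_powr filterlim_real_sequentially) auto
    then have "?g \<longlonglongrightarrow> exp (real c powr s * 0)"
      by (intro tendsto_intros)
    then show "(\<lambda>n. ereal (?g n)) \<longlonglongrightarrow> 1"
      by (simp add: one_ereal_def)
  qed simp
  finally show ?thesis .
qed

lemma one_le_limsup_root:
  fixes f :: "nat \<Rightarrow> nat"
  assumes "\<exists>\<^sub>F n in sequentially. 1 \<le> f n"
  shows "1 \<le> limsup (\<lambda>n. ereal (root n (real (f n))))"
proof (rule ccontr)
  assume "\<not> ?thesis"
  then have "\<forall>\<^sub>F n in sequentially. ereal (root n (real (f n))) < 1"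
    by (intro Limsup_lessD) simp
  then have "\<forall>\<^sub>F n in sequentially. \<not> 1 \<le> f n"
    using eventually_gt_at_top[of 0]
  proof eventually_elim
    case (elim n)
    then show ?case by (simp add: one_ereal_def)
  qed
  with assms show False unfolding frequently_def by blast
qed

section \<open>The entropy dichotomy\<close>

theorem proposition5p4:
  fixes scale :: "'k::field \<Rightarrow> 'a::{ring,monoid_mult} \<Rightarrow> 'a"
    and A :: "nat \<Rightarrow> 'a set"
  assumes "unital_algebra scale"
    and "unital_algebra.affine_algebra scale"
    and "unital_algebra.nat_graded scale A"
    and "\<forall>n. unital_algebra.fin_dim scale (A n)"
    and "unital_algebra.GK_superdim scale < 1"
  shows "(\<not> unital_algebra.fin_dim scale UNIV \<longrightarrow> unital_algebra.graded_entropy scale A = 1) \<and>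
         (unital_algebra.fin_dim scale UNIV \<longrightarrow> unital_algebra.graded_entropy scale A = 0)"
proof -
  interpret unital_algebra scale by fact
  note graded = assms(3)
  have fin: "fin_dim (A n)" for n using assms(4) by blast
  define V where "V = (SOME V. generating_subspace V)"
  have V: "generating_subspace V"
    unfolding V_def using assms(2) by (rule affine_algebra_generating_subspace)
  then have "fin_dim V" unfolding generating_subspace_def by blast
  obtain s where s: "s < 1" "\<forall>\<^sub>F n in sequentially. real (growth V n) \<le> exp (real n powr s)"
    using loglog_limsup_less_one assms(5) unfolding GK_superdim_def superdim_wrt_def V_def by metis
  obtain c where c: "0 < c" "\<And>n. 0 < n \<Longrightarrow> A n \<subseteq> subspace_power V (c * n)"
    using component_subset_power_generating[OF graded V fin] by blast
  have "dim (A n) \<le> growth V (c * n)" if "0 < n" for n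
    unfolding growth_def
    by (rule dim_mono_fin_dim[OF fin_dim_subspace_power[OF \<open>fin_dim V\<close>] c(2)[OF that]])
  then have upper: "graded_entropy A \<le> 1"
    unfolding graded_entropy_def by (rule limsup_root_le_one[OF c(1) _ s(2,1)])
  show ?thesis
  proof (intro conjI impI)
    assume "\<not> fin_dim UNIV"
    then have "\<exists>\<^sub>F n in sequentially. \<not> A n \<subseteq> {0}"
      unfolding fin_dim_UNIV_iff[OF graded fin] not_eventually .
    then have "\<exists>\<^sub>F n in sequentially. 1 \<le> dim (A n)"
      by (rule frequently_elim1) (use dim_pos_if_nonzero[OF fin] in blast)
    then have "1 \<le> graded_entropy A"
      unfolding graded_entropy_def by (rule one_le_limsup_root)
    with upper show "graded_entropy A = 1" by (rule antisym)
  next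
    assume "fin_dim UNIV"
    then have "\<forall>\<^sub>F n in sequentially. A n \<subseteq> {0}"
      unfolding fin_dim_UNIV_iff[OF graded fin] .
    then have "\<forall>\<^sub>F n in sequentially. ereal (root n (real (dim (A n)))) = 0"
    proof eventually_elim
      case (elim n)
      have "dim (A n) \<le> card ({} :: 'a set)"
        using elim by (intro dim_le_card) auto
      then show ?case by simp
    qed
    then have "graded_entropy A = limsup (\<lambda>n. 0)"
      unfolding graded_entropy_def by (rule Limsup_eq)
    then show "graded_entropy A = 0" by (simp add: Limsup_const)
  qed
qed

end
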